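(* Let $t\ge1$ and let $D$ be an arbitrary fixed set of $t$ positive integers. Set $D_0=\{2,4,\dots,2t\}$. Then for all sufficiently large $n$ (depending on $D$), $$A(n,D)\le A(n,D_0)=\sum_{i=0}^{t}\binom{n-1}{i}.$$ Furthermore, if $D$ contains at least one odd integer, then for all sufficiently large $n$ $$A(n,D)\le 2\sum_{i=0}^{t-1}\binom{n-1}{i},$$ where the right-hand side is $o(n^t)$ as $n\to\infty$, whereas $A(n,D_0)\sim\frac{1}{t!}n^t$ as $n\to\infty$.
   Context: For a set $D$ of positive integers, $A(n,D)$ denotes the maximum size of a family $\mathcal F\subseteq 2^{[n]}$ of subsets of $[n]=\{1,\dots,n\}$ such that $|A\triangle B|\in D$ for all distinct $A,B\in\mathcal F$, where $\triangle$ denotes symmetric difference. *)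

theory Defs
  imports Complex_Main "HOL-Library.Landau_Symbols"
begin

definition distance_family :: "nat \<Rightarrow> nat set \<Rightarrow> nat set set \<Rightarrow> bool" where
  "distance_family n D F \<longleftrightarrow>
     F \<subseteq> Pow {1..n} \<and> (\<forall>A\<in>F. \<forall>B\<in>F. A \<noteq> B \<longrightarrow> card (sym_diff A B) \<in> D)"

(* The maximum is over a finite nonempty set: Pow {1..n} is finite and the empty family qualifies. *)
definition A_max :: "nat \<Rightarrow> nat set \<Rightarrow> nat" where
  "A_max n D = Max {card F | F. distance_family n D F}"

end

theory Submission
  imports Defs
begin

text \<open>
  For \<open>P(x) = (\<Prod>d\<in>D. x - d)\<close> the matrix \<open>P(|A \<triangle> B|)\<close> indexed by a family with distances in
  \<open>D\<close> is \<open>P(0)\<close> times the identity, and \<open>P(0)\<close> has sign \<open>(-1)\<^sup>t\<close>. On the other hand, once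
  \<open>n \<ge> 2 max D\<close>, the quadratic form of this matrix is a combination of the squares
  \<open>(\<Sum>A. v\<^sub>A \<chi>\<^sub>S(A))\<^sup>2\<close> over \<open>|S| \<le> t\<close>, where \<open>\<chi>\<^sub>S\<close> are the Walsh characters and the coefficient
  of each square has sign \<open>(-1)\<^sup>|\<^sup>S\<^sup>|\<close>. By inertia the family is no larger than the number of
  sets \<open>S\<close> with \<open>|S| \<le> t\<close> and \<open>|S|\<close> of the parity of \<open>t\<close>, and these sets themselves form a
  family with distances in \<open>{2, 4, \<dots>, 2t}\<close>. If \<open>D\<close> contains an odd number, each of the two parity
  classes of the family has at most \<open>t - 1\<close> distances.
\<close>

section \<open>Linear algebra: underdetermined homogeneous systems\<close>

text \<open>Gaussian elimination by induction on the equations: an equation with a nonzero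
  coefficient at \<open>b\<close> removes the unknown \<open>b\<close> from the others, leaving one
  equation and one unknown fewer. This dimension count stands in for the inertia argument.\<close>

lemma homogeneous_system_nontrivial_solution:
  fixes g :: "'b \<Rightarrow> 'a \<Rightarrow> real"
  assumes "finite T" "finite F" "card T < card F"
  shows "\<exists>v. (\<exists>a\<in>F. v a \<noteq> 0) \<and> (\<forall>s\<in>T. (\<Sum>a\<in>F. v a * g s a) = 0)"
  using assms
proof (induction T arbitrary: F g rule: finite_induct)
  case empty
  then have "F \<noteq> {}" by auto
  then show ?case by (intro exI[of _ "\<lambda>_. 1"]) auto
next
  case (insert s T)
  show ?case
  proof (cases "\<forall>a\<in>F. g s a = 0")
    case True
    have "card T < card F" using insert by simp
    from insert.IH[OF insert.prems(1) this, of g] obtain v where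
      "\<exists>a\<in>F. v a \<noteq> 0" "\<forall>s\<in>T. (\<Sum>a\<in>F. v a * g s a) = 0" by blast
    with True show ?thesis by (intro exI[of _ v]) auto
  next
    case False
    then obtain b where b: "b \<in> F" "g s b \<noteq> 0" by blast
    \<comment> \<open>Row \<open>r\<close> minus the multiple of row \<open>s\<close> that cancels
      its entry at \<open>b\<close>.\<close>
    define h where "h r a = g r a - g r b * g s a / g s b" for r a
    have "card T < card (F - {b})" using insert b by simp
    with insert.IH[of "F - {b}" h] insert.prems(1) obtain v where
      v: "\<exists>a\<in>F - {b}. v a \<noteq> 0" "\<forall>r\<in>T. (\<Sum>a\<in>F - {b}. v a * h r a) = 0" by blast
    \<comment> \<open>The value that equation \<open>s\<close> forces on the eliminated unknown
      \<open>b\<close>.\<close>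
    define c where "c = - (\<Sum>a\<in>F - {b}. v a * g s a) / g s b"
    have split: "(\<Sum>a\<in>F. (v(b := c)) a * g r a) = c * g r b + (\<Sum>a\<in>F - {b}. v a * g r a)" for r
      using insert.prems(1) b(1) by (simp add: sum.remove[of F b])
    have "(\<Sum>a\<in>F. (v(b := c)) a * g r a) = 0" if "r \<in> T" for r
    proof -
      have "0 = (\<Sum>a\<in>F - {b}. v a * g r a - g r b / g s b * (v a * g s a))"
        using v(2) that by (auto simp: h_def algebra_simps)
      also have "\<dots> = (\<Sum>a\<in>F - {b}. v a * g r a) - g r b / g s b * (\<Sum>a\<in>F - {b}. v a * g s a)"
        by (simp only: sum_subtractf sum_distrib_left)
      finally have "(\<Sum>a\<in>F - {b}. v a * g r a) = g r b / g s b * (\<Sum>a\<in>F - {b}. v a * g s a)" by simp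
      then show ?thesis unfolding split by (simp add: c_def)
    qed
    moreover have "(\<Sum>a\<in>F. (v(b := c)) a * g s a) = 0"
      unfolding split using b(2) by (simp add: c_def)
    moreover have "\<exists>a\<in>F. (v(b := c)) a \<noteq> 0" using v(1) by auto
    ultimately show ?thesis by (intro exI[of _ "v(b := c)"]) blast
  qed
qed

section \<open>Walsh characters and the expansion of the annihilator polynomial\<close>

definition walsh :: "'a set \<Rightarrow> 'a set \<Rightarrow> real" where
  "walsh S X = (-1) ^ card (S \<inter> X)"

lemma card_sym_diff_even:
  assumes "finite A" "finite B"
  shows "even (card (sym_diff A B)) \<longleftrightarrow> (even (card A) \<longleftrightarrow> even (card B))"
proof -
  have "card A = card (A - B) + card (A \<inter> B)" "card B = card (B - A) + card (A \<inter> B)"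
    using card_Int_Diff[OF assms(1), of B] card_Int_Diff[OF assms(2), of A] by (auto simp: Int_commute)
  moreover have "card (sym_diff A B) = card (A - B) + card (B - A)"
    using assms by (intro card_Un_disjoint) auto
  ultimately show ?thesis by auto
qed

lemma minus_one_power_card_sym_diff:
  assumes "finite A" "finite B"
  shows "(-1 :: real) ^ card (sym_diff A B) = (-1) ^ card A * (-1) ^ card B"
  using card_sym_diff_even[OF assms] by (cases "even (card A)"; cases "even (card B)") auto

lemma walsh_commute: "walsh S X = walsh X S"
  by (simp add: walsh_def Int_commute)

lemma walsh_sym_diff:
  assumes "finite S"
  shows "walsh S (sym_diff A B) = walsh S A * walsh S B"
proof -
  have "S \<inter> sym_diff A B = sym_diff (S \<inter> A) (S \<inter> B)" by auto
  then show ?thesis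
    using minus_one_power_card_sym_diff[of "S \<inter> A" "S \<inter> B"] assms by (simp add: walsh_def)
qed

lemma walsh_singleton: "walsh {j} X = (if j \<in> X then -1 else 1)"
  by (auto simp: walsh_def)

text \<open>Each \<open>j\<close> in \<open>V\<close> contributes 1 - 2[j in X] to the sum. Size is
  thus affine in the characters of singletons, so multiplying by |X| - d becomes an operation on
  Walsh coefficients.\<close>

lemma card_eq_walsh_sum:
  assumes "finite V" "X \<subseteq> V"
  shows "real (card X) = (real (card V) - (\<Sum>j\<in>V. walsh {j} X)) / 2"
proof -
  have "(\<Sum>j\<in>V. walsh {j} X) = (\<Sum>j\<in>V. 1 - 2 * (if j \<in> X then 1 else 0))"
    by (intro sum.cong) (auto simp: walsh_singleton)
  also have "\<dots> = real (card V) - 2 * real (card (V \<inter> X))"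
    using assms(1) by (simp add: sum_subtractf sum.If_cases flip: sum_distrib_left)
  also have "V \<inter> X = X" using assms by auto
  finally show ?thesis by simp
qed

lemma sum_Pow_sym_diff:
  assumes "j \<in> V"
  shows "(\<Sum>S\<in>Pow V. f (sym_diff S {j})) = (\<Sum>S\<in>Pow V. f S)"
  by (rule sum.reindex_bij_witness[where i = "\<lambda>S. sym_diff S {j}" and j = "\<lambda>S. sym_diff S {j}"])
    (use assms in auto)

text \<open>Multiplying by \<open>|X| - d\<close> convolves the coefficients with
  \<open>(|V| - 2d) \<delta>\<^sub>\<emptyset> - (\<Sum>j. \<delta>\<^sub>j)\<close> up to the factor \<open>1/2\<close>; the sign \<open>(-1)\<^sup>|\<^sup>S\<^sup>|\<close>
  absorbs the minus sign, so nonnegativity of the weights is preserved.\<close>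
lemma annihilator_walsh_expansion:
  fixes V :: "'a set" and D :: "nat set"
  assumes "finite V" "finite D" "\<forall>d\<in>D. 2 * d \<le> card V"
  shows "\<exists>w :: 'a set \<Rightarrow> real. (\<forall>S. w S \<ge> 0) \<and> (\<forall>S\<subseteq>V. card S > card D \<longrightarrow> w S = 0) \<and>
    (\<forall>X\<subseteq>V. (\<Prod>d\<in>D. real (card X) - real d) = (\<Sum>S\<in>Pow V. (-1) ^ card S * w S * walsh S X))"
  using assms(2,3)
proof (induction D rule: finite_induct)
  case empty
  have "(\<Sum>S\<in>Pow V. (-1) ^ card S * (if S = {} then 1 else 0) * walsh S X) = 1" for X
    using assms(1) by (subst sum.remove[of _ "{}"]) (auto simp: walsh_def)
  moreover have "S = {}" if "S \<subseteq> V" "card S = 0" for S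
    using that card_0_eq[OF finite_subset[OF that(1) assms(1)]] by simp
  ultimately show ?case
    by (intro exI[of _ "\<lambda>S. if S = {} then 1 else 0"]) auto
next
  case (insert d D)
  then obtain w :: "'a set \<Rightarrow> real" where w: "\<And>S. w S \<ge> 0"
    "\<And>S. S \<subseteq> V \<Longrightarrow> card S > card D \<Longrightarrow> w S = 0"
    "\<And>X. X \<subseteq> V \<Longrightarrow> (\<Prod>d\<in>D. real (card X) - real d) = (\<Sum>S\<in>Pow V. (-1) ^ card S * w S * walsh S X)"
    by auto
  define w' where
    "w' S = ((real (card V) - 2 * real d) * w S + (\<Sum>j\<in>V. w (sym_diff S {j}))) / 2" for S
  \<comment> \<open>The coefficient |V| - 2d of \<open>w S\<close> in \<open>w'\<close> must not be
    negative.\<close>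
  have "2 * d \<le> card V" using insert.prems by auto
  then have d: "2 * real d \<le> real (card V)" by linarith
  have "w' S \<ge> 0" for S
    using d w(1) by (auto simp: w'_def intro!: add_nonneg_nonneg mult_nonneg_nonneg sum_nonneg)
  moreover have "w' S = 0" if S: "S \<subseteq> V" "card S > card (insert d D)" for S
  proof -
    have fS: "finite S" using S assms(1) finite_subset by blast
    have "w (sym_diff S {j}) = 0" if "j \<in> V" for j
    proof (rule w(2))
      show "sym_diff S {j} \<subseteq> V" using S that by auto
      \<comment> \<open>Toggling one element lowers the size by at most one, so the toggled set
        still exceeds \<open>card D\<close>.\<close>
      have "card S \<le> card (insert j (sym_diff S {j}))" using fS by (intro card_mono) auto
      also have "\<dots> \<le> Suc (card (sym_diff S {j}))" using fS by (simp add: card_insert_if)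
      finally show "card D < card (sym_diff S {j})" using S insert by simp
    qed
    moreover have "w S = 0" using w(2)[of S] S insert by simp
    ultimately show ?thesis by (simp add: w'_def)
  qed
  moreover have "(\<Prod>d\<in>insert d D. real (card X) - real d)
      = (\<Sum>S\<in>Pow V. (-1) ^ card S * w' S * walsh S X)" if X: "X \<subseteq> V" for X
  proof -
    have fX: "finite X" using X assms(1) finite_subset by blast
    let ?P = "\<Sum>S\<in>Pow V. (-1) ^ card S * w S * walsh S X"
    \<comment> \<open>Multiplication by the character of \<open>{j}\<close> permutes the characters
      by toggling \<open>j\<close>; each toggle changes the parity of |S|, hence the minus
      sign.\<close>
    have shift: "walsh {j} X * ?P = - (\<Sum>S\<in>Pow V. (-1) ^ card S * w (sym_diff S {j}) * walsh S X)"
      if j: "j \<in> V" for j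
    proof -
      have "(\<Sum>S\<in>Pow V. (-1) ^ card S * w (sym_diff S {j}) * walsh S X)
        = (\<Sum>S\<in>Pow V. (-1) ^ card (sym_diff S {j}) * w (sym_diff (sym_diff S {j}) {j}) * walsh (sym_diff S {j}) X)"
        using sum_Pow_sym_diff[OF j, of "\<lambda>S. (-1) ^ card S * w (sym_diff S {j}) * walsh S X"] by simp
      also have "\<dots> = (\<Sum>S\<in>Pow V. - (walsh {j} X * ((-1) ^ card S * w S * walsh S X)))"
      proof (intro sum.cong refl)
        fix S assume "S \<in> Pow V"
        then have fS: "finite S" using assms(1) finite_subset by auto
        have 1: "(-1 :: real) ^ card (sym_diff S {j}) = - ((-1) ^ card S)"
          using minus_one_power_card_sym_diff[OF fS, of "{j}"] by simp
        have 2: "walsh (sym_diff S {j}) X = walsh S X * walsh {j} X"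
          using walsh_sym_diff[OF fX, of S "{j}"] by (simp only: walsh_commute)
        have 3: "sym_diff (sym_diff S {j}) {j} = S" by auto
        show "(-1) ^ card (sym_diff S {j}) * w (sym_diff (sym_diff S {j}) {j}) * walsh (sym_diff S {j}) X
          = - (walsh {j} X * ((-1) ^ card S * w S * walsh S X))"
          unfolding 1 2 3 by simp
      qed
      finally show ?thesis by (simp add: sum_negf sum_distrib_left)
    qed
    have "(\<Prod>d\<in>insert d D. real (card X) - real d) = (real (card X) - real d) * ?P"
      using insert.hyps w(3)[OF X] by simp
    also have "\<dots> = ((real (card V) - 2 * real d) * ?P - (\<Sum>j\<in>V. walsh {j} X * ?P)) / 2"
      unfolding card_eq_walsh_sum[OF assms(1) X] sum_distrib_right[symmetric]
      by (simp add: field_simps)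
    also have "(\<Sum>j\<in>V. walsh {j} X * ?P)
      = - (\<Sum>j\<in>V. \<Sum>S\<in>Pow V. (-1) ^ card S * w (sym_diff S {j}) * walsh S X)"
      using shift by (simp add: sum_negf)
    also have "(\<Sum>j\<in>V. \<Sum>S\<in>Pow V. (-1) ^ card S * w (sym_diff S {j}) * walsh S X)
      = (\<Sum>S\<in>Pow V. (-1) ^ card S * (\<Sum>j\<in>V. w (sym_diff S {j})) * walsh S X)"
      by (subst sum.swap) (simp add: sum_distrib_left sum_distrib_right)
    \<comment> \<open>The minus from \<open>shift\<close> cancels the one in front of the sum, so
      both parts of \<open>w'\<close> enter with a plus.\<close>
    also have "((real (card V) - 2 * real d) * ?P
        - - (\<Sum>S\<in>Pow V. (-1) ^ card S * (\<Sum>j\<in>V. w (sym_diff S {j})) * walsh S X)) / 2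
      = (\<Sum>S\<in>Pow V. (-1) ^ card S * w' S * walsh S X)"
      by (simp add: w'_def sum_distrib_left sum_divide_distrib flip: sum.distrib)
        (intro sum.cong refl; simp add: field_simps sum_distrib_left)
    finally show ?thesis .
  qed
  ultimately show ?case by blast
qed

section \<open>Bounded sets of one parity\<close>

text \<open>It serves twice: as the index set of the squares whose sign agrees with that of P(0),
  and as the extremal family. Hence the upper and lower bounds coincide.\<close>

definition parity_ball :: "'a set \<Rightarrow> nat \<Rightarrow> 'a set set" where
  "parity_ball V t = {S. S \<subseteq> V \<and> card S \<le> t \<and> (even (card S) \<longleftrightarrow> even t)}"

lemma finite_parity_ball: "finite V \<Longrightarrow> finite (parity_ball V t)"
  by (rule finite_subset[of _ "Pow V"]) (auto simp: parity_ball_def)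

lemma card_subsets_le:
  assumes "finite V"
  shows "card {S. S \<subseteq> V \<and> card S \<le> t} = (\<Sum>i=0..t. card V choose i)"
proof -
  have "{S. S \<subseteq> V \<and> card S \<le> t} = (\<Union>i\<in>{0..t}. {S. S \<subseteq> V \<and> card S = i})" by auto
  also have "card \<dots> = (\<Sum>i=0..t. card {S. S \<subseteq> V \<and> card S = i})"
    using assms by (intro card_UN_disjoint) auto
  finally show ?thesis using n_subsets[OF assms] by simp
qed

text \<open>Deleting a fixed \<open>x\<close> is a bijection onto the subsets of
  \<open>V - {x}\<close> of size at most \<open>t\<close>: the prescribed parity tells whether
  \<open>x\<close> was present.\<close>

lemma card_parity_ball:
  assumes "finite V" "V \<noteq> {}"
  shows "card (parity_ball V t) = (\<Sum>i=0..t. (card V - 1) choose i)"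
proof -
  obtain x where x: "x \<in> V" using assms by blast
  let ?U = "{T. T \<subseteq> V - {x} \<and> card T \<le> t}"
  let ?f = "\<lambda>T. if even (card T) \<longleftrightarrow> even t then T else insert x T"
  have "bij_betw (\<lambda>S. S - {x}) (parity_ball V t) ?U"
  proof (rule bij_betw_byWitness[where f' = ?f])
    have fin: "finite S" if "S \<subseteq> V" for S using that assms(1) finite_subset by blast
    show "\<forall>S\<in>parity_ball V t. ?f (S - {x}) = S"
    proof
      fix S assume S: "S \<in> parity_ball V t"
      show "?f (S - {x}) = S"
      proof (cases "x \<in> S")
        case True
        then have "card S = Suc (card (S - {x}))"
          using S fin by (metis (lifting) card.remove parity_ball_def mem_Collect_eq)
        then show ?thesis using S True by (auto simp: parity_ball_def)
      next
        case False
        then show ?thesis using S by (auto simp: parity_ball_def)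
      qed
    qed
    show "\<forall>T\<in>?U. ?f T - {x} = T" by auto
    show "(\<lambda>S. S - {x}) ` parity_ball V t \<subseteq> ?U"
      using fin by (auto simp: parity_ball_def intro: order_trans[OF card_Diff1_le])
    show "?f ` ?U \<subseteq> parity_ball V t"
    proof clarify
      fix T assume T: "T \<subseteq> V - {x}" "card T \<le> t"
      then have "finite T" "x \<notin> T" using fin by auto
      then have c: "card (insert x T) = Suc (card T)" by simp
      show "?f T \<in> parity_ball V t"
      proof (cases "even (card T) \<longleftrightarrow> even t")
        case True
        then show ?thesis using T by (auto simp: parity_ball_def)
      next
        case False
        \<comment> \<open>The parity mismatch leaves room for \<open>x\<close> without exceeding
          size \<open>t\<close>.\<close>
        then have "card T \<noteq> t" by auto
        then show ?thesis using False T c x by (auto simp: parity_ball_def)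
      qed
    qed
  qed
  then have "card (parity_ball V t) = card ?U" by (rule bij_betw_same_card)
  then show ?thesis using card_subsets_le[of "V - {x}" t] assms x by simp
qed

section \<open>Upper bound by a quadratic form\<close>

text \<open>A family larger than the parity ball admits a nonzero \<open>v\<close> orthogonal to
  every character indexed by the ball. Then (-1)^t times the quadratic form at \<open>v\<close> is
  positive by the distance condition, yet at most 0 by the Walsh expansion.\<close>

theorem card_distance_family_le:
  assumes "distance_family n D F" "finite D" "\<forall>d\<in>D. 0 < d \<and> 2 * d \<le> n" "n \<ge> 1"
  shows "card F \<le> (\<Sum>i=0..card D. (n - 1) choose i)"
proof (rule ccontr)
  let ?V = "{1..n}" and ?t = "card D"
  assume "\<not> ?thesis"
  then have "card (parity_ball ?V ?t) < card F"
    using card_parity_ball[of ?V ?t] assms(4) by simp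
  moreover have FV: "F \<subseteq> Pow ?V" using assms(1) by (simp add: distance_family_def)
  then have fF: "finite F" by (rule finite_subset) simp
  ultimately obtain v where v: "\<exists>A\<in>F. v A \<noteq> 0"
    "\<And>S. S \<in> parity_ball ?V ?t \<Longrightarrow> (\<Sum>A\<in>F. v A * walsh S A) = 0"
    using homogeneous_system_nontrivial_solution[OF finite_parity_ball, of ?V F ?t walsh] by auto
  obtain w :: "nat set \<Rightarrow> real" where w: "\<And>S. w S \<ge> 0"
    "\<And>S. S \<subseteq> ?V \<Longrightarrow> card S > ?t \<Longrightarrow> w S = 0"
    "\<And>X. X \<subseteq> ?V \<Longrightarrow> (\<Prod>d\<in>D. real (card X) - real d) = (\<Sum>S\<in>Pow ?V. (-1) ^ card S * w S * walsh S X)"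
    using annihilator_walsh_expansion[of ?V D] assms(2,3) by auto
  let ?P = "\<lambda>X :: nat set. \<Prod>d\<in>D. real (card X) - real d"
  let ?Q = "\<Sum>A\<in>F. \<Sum>B\<in>F. v A * v B * ?P (sym_diff A B)"
  \<comment> \<open>First evaluation: P vanishes on all distances in \<open>D\<close>, so only the
    diagonal survives.\<close>
  have "?Q = (\<Sum>A\<in>F. \<Sum>B\<in>F. if B = A then (v A)\<^sup>2 * ?P {} else 0)"
  proof (intro sum.cong refl)
    fix A B assume AB: "A \<in> F" "B \<in> F"
    show "v A * v B * ?P (sym_diff A B) = (if B = A then (v A)\<^sup>2 * ?P {} else 0)"
    proof (cases "B = A")
      case False
      then have "card (sym_diff A B) \<in> D" using assms(1) AB by (auto simp: distance_family_def)
      then have "?P (sym_diff A B) = 0" using assms(2) by (intro prod_zero) auto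
      then show ?thesis using False by simp
    qed (simp add: power2_eq_square)
  qed
  also have "\<dots> = (\<Sum>A\<in>F. (v A)\<^sup>2) * ?P {}"
    using fF by (simp add: sum_distrib_right)
  also have "?P {} = (-1) ^ ?t * (\<Prod>d\<in>D. real d)"
    by (simp add: prod_uminus)
  finally have Q: "?Q = (-1) ^ ?t * ((\<Sum>A\<in>F. (v A)\<^sup>2) * (\<Prod>d\<in>D. real d))"
    by (simp only: mult_ac)
  have "(-1) ^ ?t * ?Q = ((-1) ^ ?t * (-1) ^ ?t) * ((\<Sum>A\<in>F. (v A)\<^sup>2) * (\<Prod>d\<in>D. real d))"
    unfolding Q by (simp only: mult.assoc)
  then have "(-1) ^ ?t * ?Q = (\<Sum>A\<in>F. (v A)\<^sup>2) * (\<Prod>d\<in>D. real d)"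
    by (simp only: power_mult_distrib[symmetric] mult_minus_left mult_minus_right minus_minus mult_1 power_one)
  moreover have "(\<Sum>A\<in>F. (v A)\<^sup>2) > 0"
    using v(1) fF by (meson sum_pos2 zero_le_power2 zero_less_power2)
  moreover have "(\<Prod>d\<in>D. real d) > 0" using assms(3) by (intro prod_pos) auto
  ultimately have pos: "(-1) ^ ?t * ?Q > 0" by simp
  \<comment> \<open>Second evaluation: multiplicativity of the characters separates \<open>A\<close>
    from \<open>B\<close>, so that each \<open>S\<close> yields a square.\<close>
  have "?Q = (\<Sum>A\<in>F. \<Sum>B\<in>F. \<Sum>S\<in>Pow ?V. (-1) ^ card S * w S * ((v A * walsh S A) * (v B * walsh S B)))"
  proof (intro sum.cong refl)
    fix A B assume "A \<in> F" "B \<in> F"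
    then have sub: "sym_diff A B \<subseteq> ?V" using FV by auto
    have "v A * v B * ?P (sym_diff A B)
        = v A * v B * (\<Sum>S\<in>Pow ?V. (-1) ^ card S * w S * walsh S (sym_diff A B))"
      by (simp only: w(3)[OF sub])
    also have "\<dots> = (\<Sum>S\<in>Pow ?V. (-1) ^ card S * w S * ((v A * walsh S A) * (v B * walsh S B)))"
      unfolding sum_distrib_left
    proof (intro sum.cong refl)
      fix S assume "S \<in> Pow ?V"
      then have "finite S" by (auto intro: finite_subset)
      from walsh_sym_diff[OF this, of A B]
      show "v A * v B * ((-1) ^ card S * w S * walsh S (sym_diff A B))
        = (-1) ^ card S * w S * ((v A * walsh S A) * (v B * walsh S B))" by simp
    qed
    finally show "v A * v B * ?P (sym_diff A B)
      = (\<Sum>S\<in>Pow ?V. (-1) ^ card S * w S * ((v A * walsh S A) * (v B * walsh S B)))" .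
  qed
  also have "\<dots> = (\<Sum>S\<in>Pow ?V. \<Sum>A\<in>F. \<Sum>B\<in>F. (-1) ^ card S * w S * ((v A * walsh S A) * (v B * walsh S B)))"
    by (subst (2) sum.swap, subst sum.swap) (rule refl)
  also have "\<dots> = (\<Sum>S\<in>Pow ?V. (-1) ^ card S * w S * (\<Sum>A\<in>F. v A * walsh S A)\<^sup>2)"
    unfolding power2_eq_square sum_product unfolding sum_distrib_left ..
  finally have "(-1) ^ ?t * ?Q = (\<Sum>S\<in>Pow ?V. (-1) ^ (?t + card S) * w S * (\<Sum>A\<in>F. v A * walsh S A)\<^sup>2)"
    by (simp add: sum_distrib_left power_add mult.assoc)
  also have "\<dots> \<le> 0"
  proof (intro sum_nonpos)
    fix S assume S: "S \<in> Pow ?V"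
    \<comment> \<open>In turn: the weight is zero, the square is zero by choice of \<open>v\<close>,
      or the sign is -1.\<close>
    consider "card S > ?t" | "S \<in> parity_ball ?V ?t" | "odd (?t + card S)"
      using S by (force simp: parity_ball_def)
    then show "(-1) ^ (?t + card S) * w S * (\<Sum>A\<in>F. v A * walsh S A)\<^sup>2 \<le> 0"
    proof cases
      case 3
      then have "(-1 :: real) ^ (?t + card S) = -1" by simp
      then show ?thesis using w(1)[of S] by simp
    qed (use w(2) v(2) S in auto)
  qed
  finally show False using pos by simp
qed

section \<open>The extremal value and the case of an odd distance\<close>

text \<open>Sets of equal parity are at even distance, and this distance is at most |A| + |B| \<le>
  2t.\<close>

lemma distance_family_parity_ball:
  "distance_family n {2 * i | i. 1 \<le> i \<and> i \<le> t} (parity_ball {1..n} t)"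
  unfolding distance_family_def
proof (intro conjI ballI impI)
  show "parity_ball {1..n} t \<subseteq> Pow {1..n}" by (auto simp: parity_ball_def)
  fix A B assume AB: "A \<in> parity_ball {1..n} t" "B \<in> parity_ball {1..n} t" "A \<noteq> B"
  then have fin: "finite A" "finite B" by (auto simp: parity_ball_def intro: finite_subset)
  have "even (card (sym_diff A B))"
    using card_sym_diff_even[OF fin] AB by (auto simp: parity_ball_def)
  moreover have "card (sym_diff A B) \<noteq> 0" using AB(3) fin by auto
  moreover have "card (sym_diff A B) \<le> card (A \<union> B)" using fin by (intro card_mono) auto
  then have "card (sym_diff A B) \<le> 2 * t"
    using card_Un_le[of A B] AB by (auto simp: parity_ball_def)
  ultimately show "card (sym_diff A B) \<in> {2 * i | i. 1 \<le> i \<and> i \<le> t}"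
    by (auto elim!: evenE)
qed

lemma finite_distance_family_cards: "finite {card F | F. distance_family n D F}"
  by (rule finite_subset[of _ "card ` Pow (Pow {1..n})"]) (auto simp: distance_family_def)

lemma A_max_ge: "distance_family n D F \<Longrightarrow> card F \<le> A_max n D"
  unfolding A_max_def using finite_distance_family_cards by (intro Max_ge) auto

lemma A_max_le:
  assumes "\<And>F. distance_family n D F \<Longrightarrow> card F \<le> m"
  shows "A_max n D \<le> m"
proof -
  have "distance_family n D {}" by (simp add: distance_family_def)
  then show ?thesis
    unfolding A_max_def using finite_distance_family_cards[of n D] assms
    by (subst Max_le_iff) auto
qed

lemma A_max_le_sum_binomial:
  assumes "finite D" "\<forall>d\<in>D. 0 < d \<and> 2 * d \<le> n" "n \<ge> 1"
  shows "A_max n D \<le> (\<Sum>i=0..card D. (n - 1) choose i)"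
  using card_distance_family_le[OF _ assms] by (rule A_max_le)

text \<open>The hypothesis \<open>n \<ge> 4 * t\<close> gives \<open>2 * d \<le> n\<close> for all
  distances up to \<open>2 * t\<close>; the parity ball attains the resulting bound.\<close>

lemma A_max_even_distances:
  assumes "n \<ge> 4 * t" "n \<ge> 1"
  shows "A_max n {2 * i | i. 1 \<le> i \<and> i \<le> t} = (\<Sum>i=0..t. (n - 1) choose i)"
proof (rule antisym)
  have D: "{2 * i | i. 1 \<le> i \<and> i \<le> t} = (*) 2 ` {1..t}" by auto
  have "card ((*) (2::nat) ` {1..t}) = t" by (subst card_image) (auto simp: inj_on_def)
  then show "A_max n {2 * i | i. 1 \<le> i \<and> i \<le> t} \<le> (\<Sum>i=0..t. (n - 1) choose i)"
    using A_max_le_sum_binomial[of "(*) 2 ` {1..t}" n] assms unfolding D by auto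
  show "(\<Sum>i=0..t. (n - 1) choose i) \<le> A_max n {2 * i | i. 1 \<le> i \<and> i \<le> t}"
    using A_max_ge[OF distance_family_parity_ball[of n t]] card_parity_ball[of "{1..n}" t] assms
    by simp
qed

lemma distance_family_parity_class:
  assumes "distance_family n D F"
  shows "distance_family n {d \<in> D. even d} {A \<in> F. even (card A) = b}"
  unfolding distance_family_def
proof (intro conjI ballI impI)
  show "{A \<in> F. even (card A) = b} \<subseteq> Pow {1..n}" using assms by (auto simp: distance_family_def)
  fix A B assume AB: "A \<in> {A \<in> F. even (card A) = b}" "B \<in> {A \<in> F. even (card A) = b}" "A \<noteq> B"
  then have "A \<subseteq> {1..n}" "B \<subseteq> {1..n}" using assms by (auto simp: distance_family_def)
  then have "finite A" "finite B" by (auto intro: finite_subset)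
  from card_sym_diff_even[OF this] AB assms
  show "card (sym_diff A B) \<in> {d \<in> D. even d}" by (auto simp: distance_family_def)
qed

text \<open>Only the even elements of \<open>D\<close> occur within a parity class, and there are at
  most \<open>card D - 1\<close> of them; the general bound is applied to each of the two
  classes.\<close>

lemma A_max_odd_distance:
  assumes "finite D" "\<forall>d\<in>D. 0 < d \<and> 2 * d \<le> n" "n \<ge> 1" "\<exists>d\<in>D. odd d"
  shows "A_max n D \<le> 2 * (\<Sum>i=0..card D - 1. (n - 1) choose i)"
proof (rule A_max_le)
  fix F assume F: "distance_family n D F"
  let ?E = "{d \<in> D. even d}"
  have "card ?E < card D" using assms(1,4) by (intro psubset_card_mono) auto
  then have mono: "(\<Sum>i=0..card ?E. (n - 1) choose i) \<le> (\<Sum>i=0..card D - 1. (n - 1) choose i)"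
    by (intro sum_mono2) auto
  have "card {A \<in> F. even (card A) = b} \<le> (\<Sum>i=0..card D - 1. (n - 1) choose i)" for b
    using card_distance_family_le[OF distance_family_parity_class[OF F, of b]] assms mono by auto
  from this[of True] this[of False] card_Un_le[of "{A \<in> F. even (card A) = True}" "{A \<in> F. even (card A) = False}"]
  have "card ({A \<in> F. even (card A) = True} \<union> {A \<in> F. even (card A) = False})
    \<le> 2 * (\<Sum>i=0..card D - 1. (n - 1) choose i)" by linarith
  also have "{A \<in> F. even (card A) = True} \<union> {A \<in> F. even (card A) = False} = F" by auto
  finally show "card F \<le> 2 * (\<Sum>i=0..card D - 1. (n - 1) choose i)" .
qed

section \<open>Asymptotics of the binomial sums\<close>

text \<open>By induction: passing from \<open>i\<close> to \<open>i + 1\<close> multiplies the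
  quotient by (n - 1 - i) / (n (i + 1)), which tends to 1 / (i + 1).\<close>

lemma binomial_pred_over_power_tendsto:
  "(\<lambda>n. real ((n - 1) choose i) / real n ^ i) \<longlonglongrightarrow> 1 / fact i"
proof (induction i)
  case (Suc i)
  have "(\<lambda>n. real n / real n - real (Suc i) / real n) \<longlonglongrightarrow> 1 - 0"
    by (intro tendsto_diff lim_const_over_n tendsto_eventually)
      (auto intro!: eventually_mono[OF eventually_gt_at_top[of 0]])
  from tendsto_mult[OF Suc tendsto_divide[OF this tendsto_const[of "real (Suc i)"]]]
  have "(\<lambda>n. real ((n - 1) choose i) / real n ^ i * ((real n / real n - real (Suc i) / real n) / real (Suc i)))
     \<longlonglongrightarrow> 1 / fact (Suc i)"
    by (simp add: field_simps)
  then show ?case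
  proof (rule Lim_transform_eventually)
    show "\<forall>\<^sub>F n in sequentially. real ((n - 1) choose i) / real n ^ i * ((real n / real n - real (Suc i) / real n) / real (Suc i))
      = real ((n - 1) choose Suc i) / real n ^ Suc i"
      \<comment> \<open>For such \<open>n\<close> the truncated subtraction \<open>n - 1 - i\<close>
        is exact.\<close>
      using eventually_gt_at_top[of "Suc i"]
    proof eventually_elim
      case (elim n)
      have "Suc i * ((n - 1) choose Suc i) = (n - 1 - i) * ((n - 1) choose i)"
        by (metis binomial_absorb_comp binomial_absorption mult.commute)
      then have "real (Suc i) * real ((n - 1) choose Suc i) = real (n - 1 - i) * real ((n - 1) choose i)"
        by (metis of_nat_mult)
      also have "real (n - 1 - i) = real n - real (Suc i)" using elim by (simp add: of_nat_diff)
      finally have "real ((n - 1) choose Suc i)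
          = (real n - real (Suc i)) * real ((n - 1) choose i) / real (Suc i)"
        by (simp add: eq_divide_eq mult.commute del: of_nat_Suc)
      then show ?case
        by (simp only: power_Suc times_divide_times_eq divide_divide_eq_left mult_ac flip: diff_divide_distrib)
    qed
  qed
qed (auto intro!: tendsto_eventually)

text \<open>The number of terms is fixed, and each has order n^i with i < t.\<close>

lemma sum_binomial_smallo:
  assumes "t \<ge> 1"
  shows "(\<lambda>n. real (\<Sum>i=0..t-1. (n - 1) choose i)) \<in> o(\<lambda>n. real n ^ t)"
  unfolding of_nat_sum
proof (intro big_sum_in_smallo)
  fix i assume "i \<in> {0..t-1}"
  then have i: "i < t" using assms by auto
  have "(\<lambda>n. real ((n - 1) choose i)) \<in> O(\<lambda>n. real n ^ i)"
    using binomial_pred_over_power_tendsto[of i]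
    by (intro bigoI_tendsto) (auto intro!: eventually_mono[OF eventually_gt_at_top[of 0]])
  also have "(\<lambda>n. real n ^ i) \<in> o(\<lambda>n. real n ^ t)"
    using i
    by (intro landau_o.small_power_increasing smalloI_tendsto)
      (auto intro: lim_1_over_n eventually_mono[OF eventually_gt_at_top[of 0]])
  finally show "(\<lambda>n. real ((n - 1) choose i)) \<in> o(\<lambda>n. real n ^ t)" .
qed

text \<open>The term \<open>i = t\<close> supplies the limit; the others vanish after division by
  n^t.\<close>

lemma sum_binomial_asymp_equiv:
  assumes "t \<ge> 1"
  shows "(\<lambda>n. real (\<Sum>i=0..t. (n - 1) choose i)) \<sim>[at_top] (\<lambda>n. 1 / fact t * real n ^ t)"
proof (rule asymp_equivI')
  have "{0..t} = insert t {0..t-1}" using assms by auto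
  then have split: "(\<Sum>i=0..t. (n - 1) choose i) = ((n - 1) choose t) + (\<Sum>i=0..t-1. (n - 1) choose i)" for n
    using assms by simp
  have "(\<lambda>n. real (\<Sum>i=0..t-1. (n - 1) choose i) / real n ^ t) \<longlonglongrightarrow> 0"
    using smalloD_tendsto[OF sum_binomial_smallo[OF assms]] .
  from tendsto_mult[OF tendsto_const[of "fact t"] tendsto_add[OF binomial_pred_over_power_tendsto[of t] this]]
  show "(\<lambda>n. real (\<Sum>i=0..t. (n - 1) choose i) / (1 / fact t * real n ^ t)) \<longlonglongrightarrow> 1"
    unfolding split by (simp add: field_simps add_divide_distrib)
qed

theorem corollary4p4:
  fixes t :: nat and D D0 :: "nat set"
  assumes "t \<ge> 1"
    and "finite D" and "card D = t" and "\<forall>d\<in>D. d > 0"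
    and "D0 = {2 * i | i. 1 \<le> i \<and> i \<le> t}"
  shows "(\<exists>N. \<forall>n\<ge>N. A_max n D \<le> A_max n D0 \<and> A_max n D0 = (\<Sum>i=0..t. (n - 1) choose i))
    \<and> ((\<exists>d\<in>D. odd d) \<longrightarrow> (\<exists>N. \<forall>n\<ge>N. A_max n D \<le> 2 * (\<Sum>i=0..t-1. (n - 1) choose i)))
    \<and> (\<lambda>n. real (2 * (\<Sum>i=0..t-1. (n - 1) choose i))) \<in> o(\<lambda>n. real n ^ t)
    \<and> asymp_equiv (\<lambda>n. real (A_max n D0)) at_top (\<lambda>n. 1 / fact t * real n ^ t)"
proof (intro conjI impI)
  \<comment> \<open>The threshold serves both distance sets: \<open>4 * t\<close> for
    \<open>D0\<close>, and \<open>2 * d\<close> for each \<open>d\<close> in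
    \<open>D\<close>.\<close>
  define N where "N = Max (insert (4 * t) ((*) 2 ` D))"
  have N: "4 * t \<le> N" "\<And>d. d \<in> D \<Longrightarrow> 2 * d \<le> N"
    using assms(2) by (auto simp: N_def)
  have D: "\<forall>d\<in>D. 0 < d \<and> 2 * d \<le> n" if "n \<ge> N" for n
    using N(2) assms(4) that by fastforce
  have ge: "n \<ge> 4 * t" "n \<ge> 1" if "n \<ge> N" for n using that N(1) assms(1) by auto
  have D0: "A_max n D0 = (\<Sum>i=0..t. (n - 1) choose i)" if "n \<ge> N" for n
    unfolding assms(5) by (rule A_max_even_distances[OF ge[OF that]])
  show "\<exists>N. \<forall>n\<ge>N. A_max n D \<le> A_max n D0 \<and> A_max n D0 = (\<Sum>i=0..t. (n - 1) choose i)"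
    using A_max_le_sum_binomial[OF assms(2) D ge(2)] D0 assms(3) by (intro exI[of _ N]) auto
  show "\<exists>N. \<forall>n\<ge>N. A_max n D \<le> 2 * (\<Sum>i=0..t-1. (n - 1) choose i)" if "\<exists>d\<in>D. odd d"
    using A_max_odd_distance[OF assms(2) D ge(2) that] assms(3) by (intro exI[of _ N]) auto
  show "(\<lambda>n. real (2 * (\<Sum>i=0..t-1. (n - 1) choose i))) \<in> o(\<lambda>n. real n ^ t)"
    using sum_binomial_smallo[OF assms(1)] by simp
  have "\<forall>\<^sub>F n in at_top. real (\<Sum>i=0..t. (n - 1) choose i) = real (A_max n D0)"
    using eventually_ge_at_top[of N] by eventually_elim (simp add: D0)
  from asymp_equiv_cong[OF this eventually_mono[OF eventually_True]] sum_binomial_asymp_equiv[OF assms(1)]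
  show "(\<lambda>n. real (A_max n D0)) \<sim>[at_top] (\<lambda>n. 1 / fact t * real n ^ t)"
    by (metis (no_types, lifting))
qed

end
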